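(* Let $k\ge 2$, $n\ge 1$, let $\delta\in\mathbf{C}$ be a root of $(\delta^{n+k}-1)(\delta^2-1)-\delta(\delta^{k+1}-1)(\delta^{n-1}-1)$ that is not a root of unity, and let $F=S\circ J\circ T^{-1}:\mathbf{P}^k\dashrightarrow\mathbf{P}^k$ be a basic cremona map properly fixing $C$, with multiplier of $F|_C$ equal to $\delta$, such that (a) $S(\mathbf{e}_j)=T(\mathbf{e}_{j+1})$ for $0\le j\le k-1$; (b) $F^{n-1}(S(\mathbf{e}_k))=T(\mathbf{e}_0)$; (c) $F^{j}(S(\mathbf{e}_k))\notin I(F)$ for $0\le j<n-1$; (d) $T(\mathbf{e}_j)=\gamma\left(\delta^j\frac{k+1}{k-1}\cdot\frac{\delta^2-1}{\delta(\delta^{k+1}-1)}-\frac{2}{k-1}\right)$ for $0\le j\le k$. Let $S,T$ be normalized so that both $T$ and $S$ send the point $[1:\dots:1]$ to the cusp $\gamma(\infty)=\mathbf{e}_k$ of $C$. Then $L=T^{-1}\circ S\in\mathrm{Aut}(\mathbf{P}^k)$ (so that $F$ is linearly conjugate, via $T$, to $L\circ J$) is given by the $(k+1)\times(k+1)$ matrix $$L=\begin{pmatrix}0&0&\cdots&0&0&1\\ \beta_1&0&\cdots&0&0&1-\beta_1\\ 0&\beta_2&\cdots&0&0&1-\beta_2\\ \vdots&&\ddots&&&\vdots\\ 0&0&\cdots&\beta_{k-1}&0&1-\beta_{k-1}\\ 0&0&\cdots&0&\beta_k&1-\beta_k\end{pmatrix},\qquad \beta_i=\frac{\delta^i-1}{\delta(\delta^{k+1}-\delta^i)},\quad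 i=1,\dots,k.$$ That is, with rows and columns indexed by $0,\dots,k$: the last column is $(1,1-\beta_1,\dots,1-\beta_k)^t$, and for $0\le j\le k-1$ the $j$-th column has the single nonzero entry $\beta_{j+1}$, in row $j+1$.
   Context: $\mathbf{P}^k$ is complex projective space with homogeneous coordinates $[x_0:\dots:x_k]$, and $\mathbf{e}_j\in\mathbf{P}^k$ is the point whose only nonzero coordinate is the $j$-th. $C\subset\mathbf{P}^k$ is the curve of degree $k+1$ parametrized by $\gamma:\mathbf{C}\cup\{\infty\}\to\mathbf{P}^k$, $\gamma(t)=[1:t:\dots:t^{k-1}:t^{k+1}]$, $\gamma(\infty)=[0:\dots:0:1]$; its only singular point is the cusp $\gamma(\infty)$ and $C_{reg}=\gamma(\mathbf{C})$. $J:\mathbf{P}^k\dashrightarrow\mathbf{P}^k$ is the birational involution $J[x_0:\dots:x_k]=[1/x_0:\dots:1/x_k]$. A basic cremona map is a birational map of the form $F=S\circ J\circ T^{-1}$ with $S,T\in\mathrm{Aut}(\mathbf{P}^k)$; replacing $(S,T)$ by $(S\circ\Lambda,T\circ\Lambda)$ with $\Lambda$ a diagonal linear automorphism does not change $F$, and this freedom is used for the normalization of $S,T$ in the claim. $I(F)$ is the indeterminacy set of $F$. $F$ is centered on $C$ if $T(\mathbf{e}_j)\in C_{reg}$ for all $j$, and properly fixes $C$ if it is centered on $C$ and $F(C)=C$ (proper transform). In that case $F|_C$ has the form $\gamma(t)\mapsto\gamma(\delta t+\tau)$, and $\delta$ is the multiplier of $F|_C$. Matrices represent elements of $\mathrm{Aut}(\mathbf{P}^k)$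 up to nonzero scalar. *)

theory Defs
  imports Complex_Main "Jordan_Normal_Form.Gauss_Jordan_Elimination"
begin

text \<open>
  Points of \<open>\<^bold>P\<^sup>k\<close> are represented by the sets of their homogeneous coordinate vectors
  (a line of complex vectors of dimension \<open>k + 1\<close> without the origin); coordinates are indexed by
  \<open>0, \<dots>, k\<close>.
\<close>

definition pt :: "complex vec \<Rightarrow> complex vec set" where
  "pt v = {c \<cdot>\<^sub>v v |c. c \<noteq> 0}"

definition proj_space :: "nat \<Rightarrow> complex vec set set" where
  "proj_space k = pt ` (carrier_vec (Suc k) - {0\<^sub>v (Suc k)})"

definition coord_pt :: "nat \<Rightarrow> nat \<Rightarrow> complex vec set" where
  "coord_pt k j = pt (unit_vec (Suc k) j)"

definition ones_pt :: "nat \<Rightarrow> complex vec set" where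
  "ones_pt k = pt (vec (Suc k) (\<lambda>_. 1))"

text \<open>\<open>Aut(\<^bold>P\<^sup>k)\<close> is rendered by invertible matrices, taken up to a nonzero scalar.\<close>

definition aut_mat :: "nat \<Rightarrow> complex mat \<Rightarrow> bool" where
  "aut_mat k A \<longleftrightarrow> A \<in> carrier_mat (Suc k) (Suc k) \<and> invertible_mat A"

definition aut_app :: "complex mat \<Rightarrow> complex vec set \<Rightarrow> complex vec set" where
  "aut_app A p = (\<lambda>x. A *\<^sub>v x) ` p"

definition same_aut :: "complex mat \<Rightarrow> complex mat \<Rightarrow> bool" where
  "same_aut A B \<longleftrightarrow> (\<exists>c. c \<noteq> 0 \<and> A = c \<cdot>\<^sub>m B)"

text \<open>Meaningful only for invertible \<open>A\<close>.\<close>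

definition inv_mat :: "complex mat \<Rightarrow> complex mat" where
  "inv_mat A = the (mat_inverse A)"

text \<open>
  \<open>hom_poly k d f\<close>: \<open>f\<close> is (the function of) a homogeneous polynomial of degree \<open>d\<close> in
  \<open>x\<^sub>0, \<dots>, x\<^sub>k\<close>. The zero polynomial is homogeneous of every degree.
\<close>

inductive hom_poly :: "nat \<Rightarrow> nat \<Rightarrow> (complex vec \<Rightarrow> complex) \<Rightarrow> bool" for k where
  const: "hom_poly k 0 (\<lambda>_. c)"
| coord: "i \<le> k \<Longrightarrow> hom_poly k 1 (\<lambda>x. x $ i)"
| add: "hom_poly k d f \<Longrightarrow> hom_poly k d g \<Longrightarrow> hom_poly k d (\<lambda>x. f x + g x)"
| mult: "hom_poly k d f \<Longrightarrow> hom_poly k e g \<Longrightarrow> hom_poly k (d + e) (\<lambda>x. f x * g x)"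

definition zariski_closure :: "nat \<Rightarrow> complex vec set set \<Rightarrow> complex vec set set" where
  "zariski_closure k X = {p \<in> proj_space k. \<forall>d f. hom_poly k d f \<longrightarrow>
     (\<forall>q\<in>X. \<forall>x\<in>q. f x = 0) \<longrightarrow> (\<forall>x\<in>p. f x = 0)}"

text \<open>
  A rational self-map of \<open>\<^bold>P\<^sup>k\<close> is the set of all its lifts: tuples of \<open>k + 1\<close> homogeneous polynomials of
  a common degree, not all zero, possibly with common factors. \<open>rat_map k G\<close> is the rational map
  with lift \<open>G\<close>; it contains every lift proportional to \<open>G\<close> over the rational functions. Thus the
  indeterminacy set consists of the points at which no lift is nonzero.
\<close>

definition is_lift :: "nat \<Rightarrow> (complex vec \<Rightarrow> complex vec) \<Rightarrow> bool" where
  "is_lift k H \<longleftrightarrow>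
     (\<forall>x\<in>carrier_vec (Suc k). H x \<in> carrier_vec (Suc k)) \<and>
     (\<exists>x\<in>carrier_vec (Suc k). H x \<noteq> 0\<^sub>v (Suc k)) \<and>
     (\<exists>d. \<forall>i\<le>k. \<exists>f. hom_poly k d f \<and> (\<forall>x\<in>carrier_vec (Suc k). H x $ i = f x))"

type_synonym rational_map = "(complex vec \<Rightarrow> complex vec) set"

definition rat_map :: "nat \<Rightarrow> (complex vec \<Rightarrow> complex vec) \<Rightarrow> rational_map" where
  "rat_map k G = {H. is_lift k H \<and>
     (\<forall>x\<in>carrier_vec (Suc k). \<forall>i\<le>k. \<forall>j\<le>k. H x $ i * G x $ j = H x $ j * G x $ i)}"

definition indet :: "nat \<Rightarrow> rational_map \<Rightarrow> complex vec set set" where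
  "indet k F = {p \<in> proj_space k. \<forall>H\<in>F. \<forall>x\<in>p. H x = 0\<^sub>v (Suc k)}"

text \<open>The image of a point outside the indeterminacy set (and \<open>{}\<close>, which is not a point, on it).\<close>

definition rat_app :: "nat \<Rightarrow> rational_map \<Rightarrow> complex vec set \<Rightarrow> complex vec set" where
  "rat_app k F p = {H x |H x. H \<in> F \<and> x \<in> p \<and> H x \<noteq> 0\<^sub>v (Suc k)}"

definition proper_transform :: "nat \<Rightarrow> rational_map \<Rightarrow> complex vec set set \<Rightarrow> complex vec set set" where
  "proper_transform k F X = zariski_closure k (rat_app k F ` (X - indet k F))"

text \<open>\<open>F \<circ> A = A \<circ> G\<close> as rational maps, that is, \<open>A\<close> conjugates \<open>F\<close> to \<open>G\<close>.\<close>

definition conjugate_via :: "nat \<Rightarrow> complex mat \<Rightarrow> rational_map \<Rightarrow> rational_map \<Rightarrow> bool" where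
  "conjugate_via k A F G \<longleftrightarrow> (\<forall>p\<in>proj_space k.
     (aut_app A p \<in> indet k F \<longleftrightarrow> p \<in> indet k G) \<and>
     (p \<notin> indet k G \<longrightarrow> rat_app k F (aut_app A p) = aut_app A (rat_app k G p)))"

text \<open>
  The involution \<open>J[x\<^sub>0 : \<dots> : x\<^sub>k] = [1/x\<^sub>0 : \<dots> : 1/x\<^sub>k]\<close> with denominators cleared by
  \<open>x\<^sub>0 \<cdots> x\<^sub>k\<close>.
\<close>

definition J_lift :: "nat \<Rightarrow> complex vec \<Rightarrow> complex vec" where
  "J_lift k x = vec (Suc k) (\<lambda>i. \<Prod>j\<in>{..k} - {i}. x $ j)"

definition basic_cremona :: "nat \<Rightarrow> complex mat \<Rightarrow> complex mat \<Rightarrow> rational_map" where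
  "basic_cremona k S T = rat_map k (\<lambda>x. S *\<^sub>v J_lift k (inv_mat T *\<^sub>v x))"

text \<open>The cuspidal curve; the value at infinity of its parametrization is \<open>cusp\<close>.\<close>

definition gamma :: "nat \<Rightarrow> complex \<Rightarrow> complex vec set" where
  "gamma k t = pt (vec (Suc k) (\<lambda>i. if i < k then t ^ i else t ^ (k + 1)))"

definition cusp :: "nat \<Rightarrow> complex vec set" where
  "cusp k = coord_pt k k"

definition C_reg :: "nat \<Rightarrow> complex vec set set" where
  "C_reg k = range (gamma k)"

definition cusp_curve :: "nat \<Rightarrow> complex vec set set" where
  "cusp_curve k = insert (cusp k) (C_reg k)"

definition centered_on_C :: "nat \<Rightarrow> complex mat \<Rightarrow> bool" where
  "centered_on_C k T \<longleftrightarrow> (\<forall>j\<le>k. aut_app T (coord_pt k j) \<in> C_reg k)"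

definition properly_fixes_C :: "nat \<Rightarrow> complex mat \<Rightarrow> complex mat \<Rightarrow> bool" where
  "properly_fixes_C k S T \<longleftrightarrow> centered_on_C k T \<and>
     proper_transform k (basic_cremona k S T) (cusp_curve k) = cusp_curve k"

text \<open>
  The restriction of \<open>F\<close> to the curve is determined by its values off the indeterminacy set, which
  meets the curve in finitely many points.
\<close>

definition has_multiplier :: "nat \<Rightarrow> rational_map \<Rightarrow> complex \<Rightarrow> bool" where
  "has_multiplier k F \<delta> \<longleftrightarrow> (\<exists>\<tau>. \<forall>t. gamma k t \<notin> indet k F \<longrightarrow>
     rat_app k F (gamma k t) = gamma k (\<delta> * t + \<tau>))"

definition beta :: "nat \<Rightarrow> complex \<Rightarrow> nat \<Rightarrow> complex" where
  "beta k \<delta> i = (\<delta> ^ i - 1) / (\<delta> * (\<delta> ^ (k + 1) - \<delta> ^ i))"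

definition L_mat :: "nat \<Rightarrow> complex \<Rightarrow> complex mat" where
  "L_mat k \<delta> = mat (Suc k) (Suc k) (\<lambda>(i, j).
     if j = k then (if i = 0 then 1 else 1 - beta k \<delta> i)
     else if i = j + 1 then beta k \<delta> i
     else 0)"

end

theory Submission
  imports Defs "HOL-Computational_Algebra.Polynomial"
begin

text \<open>
  Let \<open>T e\<^sub>j = \<gamma>(t\<^sub>j)\<close>, \<open>\<Sigma> = \<Sum>\<^sub>j t\<^sub>j\<close> and \<open>s\<^sub>i = t\<^sub>i - \<Sigma>\<close>. Up to a scalar, the \<open>i\<close>-th coordinate of
  \<open>T\<^sup>-\<^sup>1 \<gamma>(z)\<close> is \<open>(z - s\<^sub>i) \<Prod>\<^sub>j\<^sub>\<noteq>\<^sub>i (z - t\<^sub>j)\<close>, and applying \<open>J\<close> interchanges the roles of \<open>s\<close> and \<open>t\<close>.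
  So \<open>F(\<gamma>(z)) = \<gamma>(\<delta>z + \<tau>)\<close> says that \<open>S\<close> maps the vector \<open>w(z)\<close> of the polynomials
  \<open>(z - t\<^sub>i) \<Prod>\<^sub>j\<^sub>\<noteq>\<^sub>i (z - s\<^sub>j)\<close> to \<open>r \<gamma>(\<delta>z + \<tau>)\<close>, with \<open>r\<close> constant for degree reasons. At \<open>z = s\<^sub>i\<close> the
  vector \<open>w(z)\<close> is a multiple of \<open>e\<^sub>i\<close>, and (a) forces \<open>\<delta>s\<^sub>i + \<tau> = t\<^sub>i\<^sub>+\<^sub>1\<close>, which gives the first \<open>k\<close> columns
  of \<open>L\<close> including their scale; the leading coefficients in \<open>z\<close> show that \<open>L\<close> maps \<open>(1, \<dots>, 1)\<close> to a
  multiple of itself and give the last column.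
\<close>

section \<open>Polynomials with prescribed roots\<close>

lemma degree_prod_linear:
  fixes r :: "'b \<Rightarrow> 'a :: idom"
  assumes "finite A"
  shows "degree (\<Prod>j\<in>A. [:- r j, 1:]) = card A"
  by (subst degree_prod_sum_eq) auto

text \<open>The distinguished factor with arbitrary \<open>c\<close> makes the induction work: the
  newly inserted factor takes its place in the induction hypothesis. Both coefficients are treated
  together, since the second depends on the first.\<close>

lemma coeff_linear_mult_prod:
  fixes r :: "'b \<Rightarrow> 'a :: idom"
  assumes "finite A"
  shows "coeff ([:c, 1:] * (\<Prod>j\<in>A. [:- r j, 1:])) (Suc (card A)) = 1"
    and "coeff ([:c, 1:] * (\<Prod>j\<in>A. [:- r j, 1:])) (card A) = c - (\<Sum>j\<in>A. r j)"
proof -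
  have *: "coeff ([:c, 1:] * (\<Prod>j\<in>A. [:- r j, 1:])) (Suc (card A)) = 1 \<and>
    coeff ([:c, 1:] * (\<Prod>j\<in>A. [:- r j, 1:])) (card A) = c - (\<Sum>j\<in>A. r j)"
    using assms
  proof (induction A arbitrary: c rule: finite_induct)
    case empty
    then show ?case by simp
  next
    case (insert a A)
    let ?X = "[:- r a, 1:] * (\<Prod>j\<in>A. [:- r j, 1:])"
    have split: "coeff ([:c, 1:] * p) (Suc m) = c * coeff p (Suc m) + coeff p m"
      for p :: "'a poly" and m
      by simp
    have "degree ?X \<le> 1 + card A"
      using degree_mult_le[of "[:- r a, 1:]" "\<Prod>j\<in>A. [:- r j, 1:]"] degree_prod_linear[OF insert(1), of r]
      by simp
    then have "coeff ?X (Suc (Suc (card A))) = 0"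
      by (intro coeff_eq_0) simp
    then show ?case
      using insert.IH[of "- r a"] insert.hyps split[of ?X "Suc (card A)"] split[of ?X "card A"]
      by (simp only: prod.insert sum.insert card_insert_disjoint) (simp add: algebra_simps)
  qed
  show "coeff ([:c, 1:] * (\<Prod>j\<in>A. [:- r j, 1:])) (Suc (card A)) = 1"
    "coeff ([:c, 1:] * (\<Prod>j\<in>A. [:- r j, 1:])) (card A) = c - (\<Sum>j\<in>A. r j)"
    using * by auto
qed

text \<open>A nonzero polynomial has at most as many roots as its degree. Bounding the degree
  through coefficients also covers empty \<open>A\<close>.\<close>

lemma poly_eq_0_if_roots:
  fixes p :: "'a :: idom poly"
  assumes "finite A" "\<And>x. x \<in> A \<Longrightarrow> poly p x = 0" "\<And>i. i \<ge> card A \<Longrightarrow> coeff p i = 0"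
  shows "p = 0"
proof (rule ccontr)
  assume "p \<noteq> 0"
  then have "card A \<le> card {x. poly p x = 0}"
    using assms poly_roots_finite[of p] by (intro card_mono) auto
  also have "\<dots> \<le> degree p"
    using \<open>p \<noteq> 0\<close> by (simp add: card_poly_roots_bound)
  finally show False
    using assms(3)[of "degree p"] \<open>p \<noteq> 0\<close> by simp
qed

text \<open>The vanishing coefficient just below the top one forces the last root to be minus the
  sum of the others. The difference of the two sides then has degree below \<open>card A\<close> but
  vanishes at \<open>card A\<close> points.\<close>

lemma poly_eq_prod_roots:
  fixes p :: "'a :: idom poly" and r :: "'b \<Rightarrow> 'a"
  assumes "finite A" "inj_on r A" "degree p \<le> Suc (card A)" "coeff p (card A) = 0"
    "\<And>j. j \<in> A \<Longrightarrow> poly p (r j) = 0"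
  shows "p = smult (coeff p (Suc (card A))) ([:\<Sum>j\<in>A. r j, 1:] * (\<Prod>j\<in>A. [:- r j, 1:]))"
proof -
  let ?q = "[:\<Sum>j\<in>A. r j, 1:] * (\<Prod>j\<in>A. [:- r j, 1:])"
  have q: "degree ?q \<le> Suc (card A)"
    using degree_mult_le[of "[:\<Sum>j\<in>A. r j, 1:]" "\<Prod>j\<in>A. [:- r j, 1:]"] degree_prod_linear[OF assms(1), of r]
    by simp
  let ?d = "p - smult (coeff p (Suc (card A))) ?q"
  have "?d = 0"
  proof (rule poly_eq_0_if_roots)
    show "finite (r ` A)" using assms(1) by simp
    show "poly ?d x = 0" if x: "x \<in> r ` A" for x
    proof -
      obtain j where j: "j \<in> A" "x = r j" using x by auto
      have "poly (\<Prod>j\<in>A. [:- r j, 1:]) (r j) = 0"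
        using j assms(1) by (auto simp: poly_prod intro!: prod_zero)
      then show ?thesis using assms(5)[OF j(1)] j(2) by simp
    qed
    show "coeff ?d i = 0" if "i \<ge> card (r ` A)" for i
    proof -
      have "i \<ge> card A" using that assms(2) by (simp add: card_image)
      then consider "i = card A" | "i = Suc (card A)" | "i > Suc (card A)"
        by linarith
      then show ?thesis
      proof cases
        case 1
        then show ?thesis
          using assms(4) coeff_linear_mult_prod(2)[OF assms(1), of "\<Sum>j\<in>A. r j" r] by simp
      next
        case 2
        then show ?thesis
          using coeff_linear_mult_prod(1)[OF assms(1), of "\<Sum>j\<in>A. r j" r] by simp
      next
        case 3
        then have "coeff p i = 0" "coeff ?q i = 0"
          using assms(3) q by (intro coeff_eq_0; linarith)+
        then show ?thesis by (simp only: coeff_diff coeff_smult) simp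
      qed
    qed
  qed
  then show ?thesis by simp
qed

section \<open>Invertible matrices and their action on points\<close>

lemma aut_mat_inv:
  assumes "aut_mat k A"
  shows "inv_mat A \<in> carrier_mat (Suc k) (Suc k)" "A * inv_mat A = 1\<^sub>m (Suc k)"
    "inv_mat A * A = 1\<^sub>m (Suc k)"
proof -
  have A: "A \<in> carrier_mat (Suc k) (Suc k)"
    and "invertible_mat A"
    using assms unfolding aut_mat_def by auto
  then obtain B where B: "A * B = 1\<^sub>m (Suc k)" "B * A = 1\<^sub>m (dim_row B)"
    unfolding invertible_mat_def inverts_mat_def by auto
  \<comment> \<open>\<open>invertible_mat\<close> does not state the dimensions of \<open>B\<close>;
    they are read off from the two products.\<close>
  have "dim_col B = dim_col (A * B)" by simp
  then have dc: "dim_col B = Suc k" using B(1) by simp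
  have "dim_row B = dim_col (B * A)" using B(2) by simp
  then have dr: "dim_row B = Suc k" using A by simp
  have B': "B \<in> carrier_mat (Suc k) (Suc k)" using dr dc by auto
  \<comment> \<open>\<open>mat_inverse\<close> returns \<open>None\<close> only for matrices that
    are not units of this ring.\<close>
  have "A \<in> Units (ring_mat TYPE(complex) (Suc k) ())"
    using A B B' dr unfolding Units_def by (auto simp: ring_mat_simps intro!: bexI[of _ B])
  then have "mat_inverse A \<noteq> None"
    using mat_inverse(1)[OF A, of "()"] by blast
  then obtain C where C: "mat_inverse A = Some C" by auto
  then show "inv_mat A \<in> carrier_mat (Suc k) (Suc k)" "A * inv_mat A = 1\<^sub>m (Suc k)"
    "inv_mat A * A = 1\<^sub>m (Suc k)"
    using mat_inverse(2)[OF A C] unfolding inv_mat_def by auto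
qed

lemma mult_mat_vec_inverse:
  fixes A B :: "'a :: semiring_1 mat"
  assumes "A \<in> carrier_mat m m" "B \<in> carrier_mat m m" "A * B = 1\<^sub>m m" "x \<in> carrier_vec m"
  shows "A *\<^sub>v (B *\<^sub>v x) = x"
  using assoc_mult_mat_vec[OF assms(1,2,4)] assms(3,4) by simp

lemma aut_app_pt:
  assumes "A \<in> carrier_mat m n" "v \<in> carrier_vec n"
  shows "aut_app A (pt v) = pt (A *\<^sub>v v)"
proof -
  have "aut_app A (pt v) = (\<lambda>c. A *\<^sub>v (c \<cdot>\<^sub>v v)) ` {c. c \<noteq> 0}"
    unfolding aut_app_def pt_def by auto
  also have "\<dots> = pt (A *\<^sub>v v)"
    unfolding pt_def using mult_mat_vec[OF assms] by auto
  finally show ?thesis .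
qed

lemma index_mult_mat_vec_sum:
  assumes "A \<in> carrier_mat (Suc k) (Suc k)" "x \<in> carrier_vec (Suc k)" "i \<le> k"
  shows "(A *\<^sub>v x) $ i = (\<Sum>l\<le>k. A $$ (i, l) * x $ l)"
proof -
  have "(A *\<^sub>v x) $ i = (\<Sum>l\<in>{0..<Suc k}. A $$ (i, l) * x $ l)"
    using assms by (simp add: scalar_prod_def)
  also have "{0..<Suc k} = {..k}" by auto
  finally show ?thesis .
qed

section \<open>Homogeneous polynomials and lifts under linear coordinate changes\<close>

lemma hom_poly_smult: "hom_poly k d f \<Longrightarrow> hom_poly k d (\<lambda>x. c * f x)"
  using hom_poly.mult[OF hom_poly.const] by fastforce

text \<open>Needed for empty sums. Multiplying zero by a coordinate raises its degree by
  one.\<close>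

lemma hom_poly_zero: "hom_poly k d (\<lambda>_. 0)"
proof (induction d)
  case 0
  then show ?case by (rule hom_poly.const)
next
  case (Suc d)
  have "hom_poly k (1 + d) (\<lambda>x. x $ 0 * (0::complex))"
    by (intro hom_poly.mult hom_poly.coord Suc) simp
  then show ?case by simp
qed

lemma hom_poly_sum:
  assumes "\<And>l. l \<in> A \<Longrightarrow> hom_poly k d (f l)"
  shows "hom_poly k d (\<lambda>x. \<Sum>l\<in>A. f l x)"
  using assms
  by (induction A rule: infinite_finite_induct) (auto intro: hom_poly_zero hom_poly.add)

lemma hom_poly_prod_coords:
  assumes "finite A" "A \<subseteq> {..k}"
  shows "hom_poly k (card A) (\<lambda>x. \<Prod>j\<in>A. x $ j)"
  using assms
proof (induction A rule: finite_induct)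
  case empty
  then show ?case using hom_poly.const[of k 1] by simp
next
  case (insert a A)
  then show ?case
    using hom_poly.mult[OF hom_poly.coord[of a k], of "card A" "\<lambda>x. \<Prod>j\<in>A. x $ j"] by simp
qed

text \<open>
  The agreement is only on the carrier: outside it, the product of a matrix with a vector of the
  wrong dimension is not linear in the coordinates \<open>0, \<dots>, k\<close>.
\<close>

lemma hom_poly_compose_mat:
  assumes "hom_poly k d f" "B \<in> carrier_mat (Suc k) (Suc k)"
  shows "\<exists>g. hom_poly k d g \<and> (\<forall>x\<in>carrier_vec (Suc k). f (B *\<^sub>v x) = g x)"
  using assms(1)
proof (induction rule: hom_poly.induct)
  case (const c)
  then show ?case using hom_poly.const by blast
next
  case (coord i)
  have "hom_poly k 1 (\<lambda>x. \<Sum>l\<le>k. B $$ (i, l) * x $ l)"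
    by (intro hom_poly_sum hom_poly_smult hom_poly.coord) simp
  then show ?case
    using index_mult_mat_vec_sum[OF assms(2) _ coord] by blast
next
  case (add d f g)
  then obtain f' g' where "hom_poly k d f'" "\<forall>x\<in>carrier_vec (Suc k). f (B *\<^sub>v x) = f' x"
    "hom_poly k d g'" "\<forall>x\<in>carrier_vec (Suc k). g (B *\<^sub>v x) = g' x"
    by auto
  then show ?case using hom_poly.add by (intro exI[of _ "\<lambda>x. f' x + g' x"]) auto
next
  case (mult d f e g)
  then obtain f' g' where "hom_poly k d f'" "\<forall>x\<in>carrier_vec (Suc k). f (B *\<^sub>v x) = f' x"
    "hom_poly k e g'" "\<forall>x\<in>carrier_vec (Suc k). g (B *\<^sub>v x) = g' x"
    by auto
  then show ?case using hom_poly.mult by (intro exI[of _ "\<lambda>x. f' x * g' x"]) auto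
qed

lemma J_lift_carrier [simp]: "J_lift k x \<in> carrier_vec (Suc k)"
  by (simp add: J_lift_def)

lemma is_lift_J_lift: "is_lift k (J_lift k)"
  unfolding is_lift_def
proof (intro conjI ballI bexI exI allI impI)
  show "J_lift k (vec (Suc k) (\<lambda>_. 1)) \<noteq> 0\<^sub>v (Suc k)"
  proof
    assume "J_lift k (vec (Suc k) (\<lambda>_. 1)) = 0\<^sub>v (Suc k)"
    then have "J_lift k (vec (Suc k) (\<lambda>_. 1)) $ 0 = 0" by simp
    then show False by (simp add: J_lift_def)
  qed
  show "hom_poly k k (\<lambda>x. \<Prod>j\<in>{..k} - {i}. x $ j)" if "i \<le> k" for i
    using hom_poly_prod_coords[of "{..k} - {i}" k] that by simp
qed (auto simp: J_lift_def)

text \<open>Composition with matrices keeps a common degree. The inverses serve only to exclude the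
  zero tuple: \<open>B'\<close> moves a point where \<open>H\<close> is nonzero to one that
  \<open>B\<close> sends back, and \<open>A'\<close> shows that \<open>A\<close> kills no nonzero
  value.\<close>

lemma is_lift_conj:
  assumes "is_lift k H" and A: "A \<in> carrier_mat (Suc k) (Suc k)" and B: "B \<in> carrier_mat (Suc k) (Suc k)"
    and A': "A' \<in> carrier_mat (Suc k) (Suc k)" "A' * A = 1\<^sub>m (Suc k)"
    and B': "B' \<in> carrier_mat (Suc k) (Suc k)" "B * B' = 1\<^sub>m (Suc k)"
  shows "is_lift k (\<lambda>x. A *\<^sub>v H (B *\<^sub>v x))"
  unfolding is_lift_def
proof (intro conjI ballI)
  have H: "H x \<in> carrier_vec (Suc k)" if "x \<in> carrier_vec (Suc k)" for x
    using assms(1) that unfolding is_lift_def by blast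
  show "A *\<^sub>v H (B *\<^sub>v x) \<in> carrier_vec (Suc k)" if "x \<in> carrier_vec (Suc k)" for x
    using that A B H by (metis mult_mat_vec_carrier)
  obtain x where x: "x \<in> carrier_vec (Suc k)" "H x \<noteq> 0\<^sub>v (Suc k)"
    using assms(1) unfolding is_lift_def by blast
  have "A *\<^sub>v H (B *\<^sub>v (B' *\<^sub>v x)) \<noteq> 0\<^sub>v (Suc k)"
  proof
    assume "A *\<^sub>v H (B *\<^sub>v (B' *\<^sub>v x)) = 0\<^sub>v (Suc k)"
    then have "A *\<^sub>v H x = 0\<^sub>v (Suc k)"
      using mult_mat_vec_inverse[OF B B'(1,2) x(1)] by simp
    then have "H x = A' *\<^sub>v 0\<^sub>v (Suc k)"
      using mult_mat_vec_inverse[OF A'(1) A A'(2) H[OF x(1)]] by simp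
    moreover have "A' *\<^sub>v 0\<^sub>v (Suc k) = 0\<^sub>v (Suc k)"
      using A' by (intro eq_vecI) auto
    ultimately show False using x(2) by simp
  qed
  then show "\<exists>x\<in>carrier_vec (Suc k). A *\<^sub>v H (B *\<^sub>v x) \<noteq> 0\<^sub>v (Suc k)"
    using B' x(1) by (metis mult_mat_vec_carrier)
  obtain d where d: "\<forall>i\<le>k. \<exists>f. hom_poly k d f \<and> (\<forall>x\<in>carrier_vec (Suc k). H x $ i = f x)"
    using assms(1) unfolding is_lift_def by blast
  have "\<forall>i\<le>k. \<exists>f. hom_poly k d f \<and> (\<forall>x\<in>carrier_vec (Suc k). H (B *\<^sub>v x) $ i = f x)"
  proof (intro allI impI)
    fix i assume "i \<le> k"
    then obtain f where f: "hom_poly k d f" "\<forall>x\<in>carrier_vec (Suc k). H x $ i = f x"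
      using d by blast
    obtain g where "hom_poly k d g" "\<forall>x\<in>carrier_vec (Suc k). f (B *\<^sub>v x) = g x"
      using hom_poly_compose_mat[OF f(1) B] by blast
    then show "\<exists>f. hom_poly k d f \<and> (\<forall>x\<in>carrier_vec (Suc k). H (B *\<^sub>v x) $ i = f x)"
      using f(2) B by (metis mult_mat_vec_carrier)
  qed
  then obtain f where f: "\<And>i. i \<le> k \<Longrightarrow> hom_poly k d (f i)"
    "\<And>i x. i \<le> k \<Longrightarrow> x \<in> carrier_vec (Suc k) \<Longrightarrow> H (B *\<^sub>v x) $ i = f i x"
    by metis
  have "\<exists>g. hom_poly k d g \<and> (\<forall>x\<in>carrier_vec (Suc k). (A *\<^sub>v H (B *\<^sub>v x)) $ i = g x)"
    if "i \<le> k" for i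
  proof (intro exI conjI ballI)
    show "hom_poly k d (\<lambda>x. \<Sum>l\<le>k. A $$ (i, l) * f l x)"
      by (intro hom_poly_sum hom_poly_smult f) simp
    fix x :: "complex vec" assume x: "x \<in> carrier_vec (Suc k)"
    then have "H (B *\<^sub>v x) \<in> carrier_vec (Suc k)" using H B by (metis mult_mat_vec_carrier)
    then show "(A *\<^sub>v H (B *\<^sub>v x)) $ i = (\<Sum>l\<le>k. A $$ (i, l) * f l x)"
      using index_mult_mat_vec_sum[OF A _ that] f(2) x by simp
  qed
  then show "\<exists>d. \<forall>i\<le>k. \<exists>f. hom_poly k d f \<and>
      (\<forall>x\<in>carrier_vec (Suc k). (A *\<^sub>v H (B *\<^sub>v x)) $ i = f x)"
    by blast
qed

section \<open>Conjugating rational maps\<close>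

text \<open>\<open>rat_map\<close> expresses proportionality by the vanishing of 2x2 minors. Both
  sides are bilinear in \<open>h\<close> and \<open>g\<close>; in the double sum over
  \<open>l\<close> and \<open>m\<close> the hypothesis exchanges the two indices.\<close>

lemma minors_mult_mat_vec:
  fixes A :: "'a :: comm_semiring_0 mat"
  assumes A: "A \<in> carrier_mat (Suc k) (Suc k)" and "h \<in> carrier_vec (Suc k)" "g \<in> carrier_vec (Suc k)"
    and hg: "\<And>l m. l \<le> k \<Longrightarrow> m \<le> k \<Longrightarrow> h $ l * g $ m = h $ m * g $ l"
    and "i \<le> k" "j \<le> k"
  shows "(A *\<^sub>v h) $ i * (A *\<^sub>v g) $ j = (A *\<^sub>v h) $ j * (A *\<^sub>v g) $ i"
proof -
  have *: "(A *\<^sub>v u) $ a * (A *\<^sub>v v) $ b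
      = (\<Sum>l\<le>k. \<Sum>m\<le>k. A $$ (a, l) * A $$ (b, m) * (u $ l * v $ m))"
    if "u \<in> carrier_vec (Suc k)" "v \<in> carrier_vec (Suc k)" "a \<le> k" "b \<le> k" for u v a b
    unfolding index_mult_mat_vec_sum[OF A that(1,3)] index_mult_mat_vec_sum[OF A that(2,4)] sum_product
    by (intro sum.cong refl) (simp only: mult_ac)
  have "(A *\<^sub>v h) $ i * (A *\<^sub>v g) $ j
      = (\<Sum>l\<le>k. \<Sum>m\<le>k. A $$ (i, l) * A $$ (j, m) * (h $ l * g $ m))"
    using assms by (intro *)
  also have "\<dots> = (\<Sum>l\<le>k. \<Sum>m\<le>k. A $$ (i, l) * A $$ (j, m) * (h $ m * g $ l))"
    using hg by (intro sum.cong refl) auto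
  also have "\<dots> = (\<Sum>m\<le>k. \<Sum>l\<le>k. A $$ (i, l) * A $$ (j, m) * (h $ m * g $ l))"
    by (rule sum.swap)
  also have "\<dots> = (A *\<^sub>v h) $ j * (A *\<^sub>v g) $ i"
    unfolding *[OF assms(2,3,6,5)] by (intro sum.cong refl) (simp only: mult_ac)
  finally show ?thesis .
qed

text \<open>\<open>G'\<close> is kept separate from the conjugated lift because the two are compared
  after cancelling products of inverse matrices, which is possible only on the carrier.\<close>

lemma rat_map_conj:
  assumes H: "H \<in> rat_map k G"
    and G: "\<And>x. x \<in> carrier_vec (Suc k) \<Longrightarrow> G x \<in> carrier_vec (Suc k)"
    and A: "A \<in> carrier_mat (Suc k) (Suc k)" and B: "B \<in> carrier_mat (Suc k) (Suc k)"
    and AB: "A * B = 1\<^sub>m (Suc k)" "B * A = 1\<^sub>m (Suc k)"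
    and G': "\<And>x. x \<in> carrier_vec (Suc k) \<Longrightarrow> G' x = A *\<^sub>v G (B *\<^sub>v x)"
  shows "(\<lambda>x. A *\<^sub>v H (B *\<^sub>v x)) \<in> rat_map k G'"
  unfolding rat_map_def
proof (intro CollectI conjI ballI allI impI)
  have lift: "is_lift k H" using H unfolding rat_map_def by auto
  then show "is_lift k (\<lambda>x. A *\<^sub>v H (B *\<^sub>v x))"
    using A B AB by (intro is_lift_conj) auto
  fix x :: "complex vec" and i j
  assume x: "x \<in> carrier_vec (Suc k)" and ij: "i \<le> k" "j \<le> k"
  have Bx: "B *\<^sub>v x \<in> carrier_vec (Suc k)" using B x by (rule mult_mat_vec_carrier)
  moreover have "H (B *\<^sub>v x) \<in> carrier_vec (Suc k)" using lift Bx unfolding is_lift_def by blast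
  ultimately show "(A *\<^sub>v H (B *\<^sub>v x)) $ i * G' x $ j = (A *\<^sub>v H (B *\<^sub>v x)) $ j * G' x $ i"
    unfolding G'[OF x] using H G[OF Bx] ij
    by (intro minors_mult_mat_vec[OF A]) (auto simp: rat_map_def)
qed

text \<open>The lifts of \<open>F\<close> and \<open>G\<close> correspond under conjugation. As
  \<open>A\<close> and \<open>B\<close> are injective, a lift is nonzero at a point exactly when its
  counterpart is nonzero at the transported point, so indeterminacy sets and values
  correspond.\<close>

lemma conjugate_viaI:
  assumes A: "A \<in> carrier_mat (Suc k) (Suc k)" and B: "B \<in> carrier_mat (Suc k) (Suc k)"
    and AB: "A * B = 1\<^sub>m (Suc k)" "B * A = 1\<^sub>m (Suc k)"
    and carr: "\<And>H x. H \<in> F \<Longrightarrow> x \<in> carrier_vec (Suc k) \<Longrightarrow> H x \<in> carrier_vec (Suc k)"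
      "\<And>H x. H \<in> G \<Longrightarrow> x \<in> carrier_vec (Suc k) \<Longrightarrow> H x \<in> carrier_vec (Suc k)"
    and FG: "\<And>H. H \<in> F \<Longrightarrow> (\<lambda>x. B *\<^sub>v H (A *\<^sub>v x)) \<in> G"
    and GF: "\<And>H. H \<in> G \<Longrightarrow> (\<lambda>x. A *\<^sub>v H (B *\<^sub>v x)) \<in> F"
  shows "conjugate_via k A F G"
  unfolding conjugate_via_def
proof (intro ballI conjI impI)
  fix p assume p: "p \<in> proj_space k"
  obtain v where v: "v \<in> carrier_vec (Suc k)" "v \<noteq> 0\<^sub>v (Suc k)" "p = pt v"
    using p unfolding proj_space_def by auto
  have pc: "x \<in> carrier_vec (Suc k)" if "x \<in> p" for x
    using that v unfolding pt_def by auto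
  have inv: "B *\<^sub>v (A *\<^sub>v x) = x" "A *\<^sub>v (B *\<^sub>v x) = x" if "x \<in> carrier_vec (Suc k)" for x
    using mult_mat_vec_inverse A B AB that by auto
  have z: "A *\<^sub>v 0\<^sub>v (Suc k) = 0\<^sub>v (Suc k)" "B *\<^sub>v 0\<^sub>v (Suc k) = 0\<^sub>v (Suc k)"
    using A B by (auto intro!: eq_vecI)
  have z': "A *\<^sub>v x = 0\<^sub>v (Suc k) \<longleftrightarrow> x = 0\<^sub>v (Suc k)" "B *\<^sub>v x = 0\<^sub>v (Suc k) \<longleftrightarrow> x = 0\<^sub>v (Suc k)"
    if "x \<in> carrier_vec (Suc k)" for x
    using inv[OF that] z by metis+
  have Ac: "A *\<^sub>v x \<in> carrier_vec (Suc k)" if "x \<in> carrier_vec (Suc k)" for x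
    using A that by (rule mult_mat_vec_carrier)
  have "A *\<^sub>v v \<in> carrier_vec (Suc k) - {0\<^sub>v (Suc k)}"
    using Ac z' v by auto
  moreover have "aut_app A p = pt (A *\<^sub>v v)"
    unfolding v(3) using A v(1) by (rule aut_app_pt)
  ultimately have Ap: "aut_app A p \<in> proj_space k" unfolding proj_space_def by blast
  show "aut_app A p \<in> indet k F \<longleftrightarrow> p \<in> indet k G"
  proof
    assume L: "aut_app A p \<in> indet k F"
    have "H x = 0\<^sub>v (Suc k)" if H: "H \<in> G" and x: "x \<in> p" for H x
    proof -
      have "A *\<^sub>v H (B *\<^sub>v (A *\<^sub>v x)) = 0\<^sub>v (Suc k)"
        using L GF[OF H] x unfolding indet_def aut_app_def by fastforce
      then show ?thesis using inv pc[OF x] z' carr(2)[OF H] by simp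
    qed
    then show "p \<in> indet k G" using p unfolding indet_def by auto
  next
    assume R: "p \<in> indet k G"
    have "H (A *\<^sub>v x) = 0\<^sub>v (Suc k)" if H: "H \<in> F" and x: "x \<in> p" for H x
    proof -
      have "B *\<^sub>v H (A *\<^sub>v x) = 0\<^sub>v (Suc k)"
        using R FG[OF H] x unfolding indet_def by fastforce
      then show ?thesis using pc[OF x] z' carr(1)[OF H] Ac by blast
    qed
    then show "aut_app A p \<in> indet k F" using Ap unfolding indet_def aut_app_def by auto
  qed
  show "rat_app k F (aut_app A p) = aut_app A (rat_app k G p)"
  proof (intro equalityI subsetI)
    fix y assume "y \<in> rat_app k F (aut_app A p)"
    then obtain H x where H: "H \<in> F" "x \<in> p" "y = H (A *\<^sub>v x)" "y \<noteq> 0\<^sub>v (Suc k)"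
      unfolding rat_app_def aut_app_def by auto
    have y: "y \<in> carrier_vec (Suc k)" using H carr(1) Ac pc by auto
    have "B *\<^sub>v y \<noteq> 0\<^sub>v (Suc k)" using z' y H(4) by blast
    then have "B *\<^sub>v y \<in> rat_app k G p"
      unfolding rat_app_def
      by (intro CollectI exI[of _ "\<lambda>x. B *\<^sub>v H (A *\<^sub>v x)"] exI[of _ x] conjI)
        (use FG[OF H(1)] H(2,3) in auto)
    then show "y \<in> aut_app A (rat_app k G p)"
      using inv(2)[OF y] unfolding aut_app_def by (metis imageI)
  next
    fix y assume "y \<in> aut_app A (rat_app k G p)"
    then obtain H x where H: "H \<in> G" "x \<in> p" "H x \<noteq> 0\<^sub>v (Suc k)" "y = A *\<^sub>v H x"
      unfolding rat_app_def aut_app_def by auto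
    have "y = A *\<^sub>v H (B *\<^sub>v (A *\<^sub>v x))" using H inv(1)[OF pc] by simp
    moreover have "y \<noteq> 0\<^sub>v (Suc k)" using H(3,4) z'(1)[OF carr(2)[OF H(1) pc[OF H(2)]]] by simp
    ultimately show "y \<in> rat_app k F (aut_app A p)"
      unfolding rat_app_def aut_app_def
      by (intro CollectI exI[of _ "\<lambda>x. A *\<^sub>v H (B *\<^sub>v x)"] exI[of _ "A *\<^sub>v x"] conjI)
        (use GF[OF H(1)] H(2) in auto)
  qed
qed

section \<open>The curve in the coordinates of \<open>T\<close> and \<open>S\<close>\<close>

lemma poly_eqI_cofinite:
  fixes p q :: "complex poly"
  assumes "finite Z" "\<And>z. z \<notin> Z \<Longrightarrow> poly p z = poly q z"
  shows "p = q"
proof (rule ccontr)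
  assume "p \<noteq> q"
  then have "finite {z. poly (p - q) z = 0}" by (intro poly_roots_finite) simp
  moreover have "UNIV \<subseteq> Z \<union> {z. poly (p - q) z = 0}" using assms(2) by auto
  ultimately have "finite (UNIV :: complex set)"
    using assms(1) by (meson finite_UnI finite_subset)
  then show False using infinite_UNIV_char_0 by blast
qed

lemma pt_eqD:
  assumes "pt v = pt w"
  obtains c where "c \<noteq> 0" "v = c \<cdot>\<^sub>v w"
proof -
  have "v \<in> pt v" unfolding pt_def by (auto intro!: exI[of _ 1])
  then show ?thesis using assms that unfolding pt_def by auto
qed

definition gamma_vec :: "nat \<Rightarrow> complex \<Rightarrow> complex vec" where
  "gamma_vec k t = vec (Suc k) (\<lambda>i. if i < k then t ^ i else t ^ (k + 1))"

lemma gamma_vec_carrier [simp]: "gamma_vec k t \<in> carrier_vec (Suc k)"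
  by (simp add: gamma_vec_def)

lemma gamma_eq_pt: "gamma k t = pt (gamma_vec k t)"
  by (simp add: gamma_def gamma_vec_def)

text \<open>One shape for both sides of \<open>J\<close>: up to scalars, \<open>a = s\<close>,
  \<open>b = t\<close> gives the inverse of \<open>T\<close> applied to the curve, and
  \<open>a = t\<close>, \<open>b = s\<close> gives its image under \<open>J\<close>.\<close>

definition nodal_vec :: "nat \<Rightarrow> (nat \<Rightarrow> complex) \<Rightarrow> (nat \<Rightarrow> complex) \<Rightarrow> complex \<Rightarrow> complex vec" where
  "nodal_vec k a b z = vec (Suc k) (\<lambda>i. (z - a i) * (\<Prod>j\<in>{..k} - {i}. z - b j))"

lemma nodal_vec_carrier [simp]: "nodal_vec k a b z \<in> carrier_vec (Suc k)"
  by (simp add: nodal_vec_def)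

text \<open>Every entry other than the \<open>i\<close>-th contains the factor
  \<open>b i - b i\<close>.\<close>

lemma nodal_vec_at_node:
  assumes "i \<le> k"
  shows "nodal_vec k a b (b i) =
    ((b i - a i) * (\<Prod>j\<in>{..k} - {i}. b i - b j)) \<cdot>\<^sub>v unit_vec (Suc k) i"
proof (rule eq_vecI)
  fix x assume "x < dim_vec (((b i - a i) * (\<Prod>j\<in>{..k} - {i}. b i - b j)) \<cdot>\<^sub>v unit_vec (Suc k) i)"
  then have x: "x < Suc k" by simp
  have "x \<noteq> i \<Longrightarrow> (\<Prod>j\<in>{..k} - {x}. b i - b j) = 0"
    using assms by (intro prod_zero) auto
  then show "nodal_vec k a b (b i) $ x =
      (((b i - a i) * (\<Prod>j\<in>{..k} - {i}. b i - b j)) \<cdot>\<^sub>v unit_vec (Suc k) i) $ x"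
    using x assms by (auto simp: nodal_vec_def)
qed (simp add: nodal_vec_def)

text \<open>
  \<open>\<gamma>\<close> has no component of degree \<open>k\<close>. Hence the \<open>i\<close>-th coordinate of \<open>T\<^sup>-\<^sup>1 \<gamma>\<close>, a polynomial of degree
  \<open>k + 1\<close> vanishing at the \<open>t\<^sub>j\<close> with \<open>j \<noteq> i\<close>, has its last root at minus their sum.
\<close>

lemma inverse_gamma_vec:
  assumes T: "T \<in> carrier_mat (Suc k) (Suc k)" and T': "T' \<in> carrier_mat (Suc k) (Suc k)"
    and inv: "T' * T = 1\<^sub>m (Suc k)"
    and Te: "\<And>j. j \<le> k \<Longrightarrow> \<exists>c. c \<noteq> 0 \<and> T *\<^sub>v unit_vec (Suc k) j = c \<cdot>\<^sub>v gamma_vec k (t j)"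
    and inj: "inj_on t {..k}"
    and T1: "T *\<^sub>v vec (Suc k) (\<lambda>_. 1) = m \<cdot>\<^sub>v unit_vec (Suc k) k" "m \<noteq> 0"
  shows "T' *\<^sub>v gamma_vec k z
    = (1 / m) \<cdot>\<^sub>v nodal_vec k (\<lambda>i. - (\<Sum>j\<in>{..k} - {i}. t j)) t z"
proof (rule eq_vecI)
  fix i assume "i < dim_vec ((1 / m) \<cdot>\<^sub>v nodal_vec k (\<lambda>i. - (\<Sum>j\<in>{..k} - {i}. t j)) t z)"
  then have i: "i \<le> k" by (simp add: nodal_vec_def)
  \<comment> \<open>The \<open>i\<close>-th coordinate as a polynomial in the curve parameter. The
    last entry of the row goes with exponent \<open>Suc k\<close>, so exponent \<open>k\<close> is
    absent.\<close>
  define p where "p = (\<Sum>l<k. monom (T' $$ (i, l)) l) + monom (T' $$ (i, k)) (Suc k)"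
  have pz: "poly p z = (T' *\<^sub>v gamma_vec k z) $ i" for z
  proof -
    have "(T' *\<^sub>v gamma_vec k z) $ i = (\<Sum>l\<le>k. T' $$ (i, l) * gamma_vec k z $ l)"
      using T' i by (intro index_mult_mat_vec_sum) auto
    also have "\<dots> = (\<Sum>l<k. T' $$ (i, l) * gamma_vec k z $ l) + T' $$ (i, k) * gamma_vec k z $ k"
      by (simp add: lessThan_Suc_atMost[symmetric])
    also have "(\<Sum>l<k. T' $$ (i, l) * gamma_vec k z $ l) = (\<Sum>l<k. T' $$ (i, l) * z ^ l)"
      by (intro sum.cong) (auto simp: gamma_vec_def)
    finally show ?thesis
      by (simp add: p_def poly_sum poly_monom gamma_vec_def)
  qed
  have inv': "T' *\<^sub>v (T *\<^sub>v x) = x" if "x \<in> carrier_vec (Suc k)" for x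
    using mult_mat_vec_inverse[OF T' T inv that] .
  let ?A = "{..k} - {i}"
  have cA: "card ?A = k" using i by simp
  have deg: "degree p \<le> Suc k"
    unfolding p_def
    by (intro degree_add_le degree_sum_le) (auto intro: order_trans[OF degree_monom_le])
  have ck: "coeff p k = 0"
    by (simp add: p_def coeff_sum)
  \<comment> \<open>The normalization at the cusp makes the last column of \<open>T'\<close>
    constant, so all coordinates have the same leading coefficient.\<close>
  have "coeff p (Suc k) = T' $$ (i, k)"
    by (simp add: p_def coeff_sum)
  also have "\<dots> = (T' *\<^sub>v unit_vec (Suc k) k) $ i"
    using T' i by simp
  also have "unit_vec (Suc k) k = (1 / m) \<cdot>\<^sub>v (T *\<^sub>v vec (Suc k) (\<lambda>_. 1))"
    unfolding T1(1) using T1(2) by (auto simp: smult_smult_assoc)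
  also have "T' *\<^sub>v \<dots> = (1 / m) \<cdot>\<^sub>v vec (Suc k) (\<lambda>_. 1)"
    using mult_mat_vec[OF T'] T inv' by simp
  also have "\<dots> $ i = 1 / m"
    using i by simp
  finally have ck1: "coeff p (Suc k) = 1 / m" .
  \<comment> \<open>\<open>T'\<close> sends the curve point with parameter \<open>t j\<close> to a
    multiple of the \<open>j\<close>-th unit vector, whose \<open>i\<close>-th entry is
    zero.\<close>
  have root: "poly p (t j) = 0" if j: "j \<in> ?A" for j
  proof -
    obtain c where c: "c \<noteq> 0" "T *\<^sub>v unit_vec (Suc k) j = c \<cdot>\<^sub>v gamma_vec k (t j)"
      using Te j by auto
    have "c \<cdot>\<^sub>v (T' *\<^sub>v gamma_vec k (t j)) = unit_vec (Suc k) j"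
      using inv'[of "unit_vec (Suc k) j"] mult_mat_vec[OF T', of "gamma_vec k (t j)" c] c(2) by simp
    then have "(c \<cdot>\<^sub>v (T' *\<^sub>v gamma_vec k (t j))) $ i = 0"
      using i j by simp
    then have "c * (T' *\<^sub>v gamma_vec k (t j)) $ i = 0"
      using i T' by simp
    then show ?thesis using c(1) pz by simp
  qed
  have "p = smult (1 / m) ([:\<Sum>j\<in>?A. t j, 1:] * (\<Prod>j\<in>?A. [:- t j, 1:]))"
    using poly_eq_prod_roots[of ?A t p] inj deg ck root cA ck1
    by (simp add: inj_on_diff)
  then have "poly p z = (1 / m) * ((z + (\<Sum>j\<in>?A. t j)) * (\<Prod>j\<in>?A. z - t j))"
    by (simp only: poly_smult poly_mult poly_prod) (simp add: algebra_simps)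
  then show "(T' *\<^sub>v gamma_vec k z) $ i
      = ((1 / m) \<cdot>\<^sub>v nodal_vec k (\<lambda>i. - (\<Sum>j\<in>{..k} - {i}. t j)) t z) $ i"
    using pz i by (simp add: nodal_vec_def)
qed (use T' in \<open>auto simp: nodal_vec_def\<close>)

lemma J_lift_smult:
  assumes "x \<in> carrier_vec (Suc k)"
  shows "J_lift k (c \<cdot>\<^sub>v x) = c ^ k \<cdot>\<^sub>v J_lift k x"
proof (rule eq_vecI)
  fix i assume "i < dim_vec (c ^ k \<cdot>\<^sub>v J_lift k x)"
  then have i: "i \<le> k" by (simp add: J_lift_def)
  have "(\<Prod>j\<in>{..k} - {i}. (c \<cdot>\<^sub>v x) $ j) = (\<Prod>j\<in>{..k} - {i}. c * x $ j)"
    using assms by (intro prod.cong) auto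
  then show "J_lift k (c \<cdot>\<^sub>v x) $ i = (c ^ k \<cdot>\<^sub>v J_lift k x) $ i"
    using i by (simp add: J_lift_def prod.distrib)
qed (simp add: J_lift_def)

text \<open>With \<open>P\<close> the product of all \<open>z - t j\<close>, the \<open>j\<close>-th
  entry is \<open>(z - s j) * (P / (z - t j))\<close>. Multiplying over \<open>j\<close> different
  from \<open>i\<close> turns the \<open>t\<close>-part into \<open>P ^ k\<close> divided by
  \<open>P / (z - t i)\<close>, that is \<open>P ^ (k - 1) * (z - t i)\<close>.\<close>

lemma J_lift_nodal_vec:
  assumes "k \<ge> 1" "z \<notin> t ` {..k}"
  shows "J_lift k (nodal_vec k s t z) = (\<Prod>j\<le>k. z - t j) ^ (k - 1) \<cdot>\<^sub>v nodal_vec k t s z"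
proof (rule eq_vecI)
  let ?P = "\<Prod>j\<le>k. z - t j"
  fix i assume "i < dim_vec (?P ^ (k - 1) \<cdot>\<^sub>v nodal_vec k t s z)"
  then have i: "i \<le> k" by (simp add: nodal_vec_def)
  let ?A = "{..k} - {i}"
  have nz: "z - t j \<noteq> 0" if "j \<le> k" for j
    using assms(2) that by auto
  have P: "?P \<noteq> 0" using nz by auto
  have R: "(\<Prod>l\<in>{..k} - {j}. z - t l) = ?P / (z - t j)" if "j \<le> k" for j
    using prod.remove[of "{..k}" j "\<lambda>l. z - t l"] nz[OF that] that by simp
  have "(\<Prod>j\<in>?A. nodal_vec k s t z $ j) = (\<Prod>j\<in>?A. (z - s j) * (?P / (z - t j)))"
    by (intro prod.cong refl) (simp add: nodal_vec_def R)
  also have "\<dots> = (\<Prod>j\<in>?A. z - s j) * (?P ^ k / (\<Prod>j\<in>?A. z - t j))"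
    using i by (simp add: prod.distrib prod_dividef)
  also have "\<dots> = (\<Prod>j\<in>?A. z - s j) * (?P ^ (k - 1) * (z - t i))"
    unfolding R[OF i] using P nz[OF i] assms(1)
    by (simp add: field_simps power_eq_if)
  finally show "J_lift k (nodal_vec k s t z) $ i = (?P ^ (k - 1) \<cdot>\<^sub>v nodal_vec k t s z) $ i"
    using i by (simp add: J_lift_def nodal_vec_def mult_ac)
qed (simp_all add: J_lift_def nodal_vec_def)

text \<open>
  The factor relating the two sides is a polynomial \<open>W 0\<close>; comparing degrees in the last coordinate,
  where \<open>\<gamma>\<close> has degree \<open>k + 1\<close>, shows that it is constant.
\<close>

lemma nodal_vec_image_gamma:
  assumes S: "S \<in> carrier_mat (Suc k) (Suc k)" and k: "k \<ge> 1" and \<delta>: "\<delta> \<noteq> 0" and Z: "finite Z"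
    and SN: "\<And>z. z \<notin> Z \<Longrightarrow> \<exists>c. c \<noteq> 0 \<and> S *\<^sub>v nodal_vec k t s z = c \<cdot>\<^sub>v gamma_vec k (\<delta> * z + \<tau>)"
  obtains r where "r \<noteq> 0" "\<And>z. S *\<^sub>v nodal_vec k t s z = r \<cdot>\<^sub>v gamma_vec k (\<delta> * z + \<tau>)"
    "S *\<^sub>v vec (Suc k) (\<lambda>_. 1) = (r * \<delta> ^ Suc k) \<cdot>\<^sub>v unit_vec (Suc k) k"
proof -
  define N where "N i = [:- t i, 1:] * (\<Prod>j\<in>{..k} - {i}. [:- s j, 1:])" for i
  define W where "W m = (\<Sum>l\<le>k. smult (S $$ (m, l)) (N l))" for m
  \<comment> \<open>The exponents occurring in \<open>gamma_vec\<close>, with \<open>k\<close>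
    skipped.\<close>
  define e where "e m = (if m < k then m else Suc k)" for m
  have Nz: "poly (N i) z = nodal_vec k t s z $ i" if "i \<le> k" for i z
    using that by (simp add: N_def nodal_vec_def poly_prod algebra_simps)
  have degN: "degree (N i) \<le> Suc k" if "i \<le> k" for i
  proof -
    have "degree (N i) \<le> degree [:- t i, 1:] + degree (\<Prod>j\<in>{..k} - {i}. [:- s j, 1:])"
      unfolding N_def by (rule degree_mult_le)
    then show ?thesis using that degree_prod_linear[of "{..k} - {i}" s] by simp
  qed
  have Nk1: "coeff (N i) (Suc k) = 1" if "i \<le> k" for i
    using that coeff_linear_mult_prod(1)[of "{..k} - {i}" "- t i" s] by (simp add: N_def)
  have Wz: "poly (W m) z = (S *\<^sub>v nodal_vec k t s z) $ m" if "m \<le> k" for m z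
    using index_mult_mat_vec_sum[OF S nodal_vec_carrier that] by (simp add: W_def poly_sum Nz)
  have degW: "degree (W m) \<le> Suc k" for m
    unfolding W_def
    by (intro degree_sum_le) (auto intro: order_trans[OF degree_smult_le] degN)
  \<comment> \<open>All \<open>N l\<close> are monic of degree \<open>Suc k\<close>, so the top
    coefficient of \<open>W m\<close> is the \<open>m\<close>-th row sum of
    \<open>S\<close>.\<close>
  have Wk1: "coeff (W m) (Suc k) = (S *\<^sub>v vec (Suc k) (\<lambda>_. 1)) $ m" if "m \<le> k" for m
    using index_mult_mat_vec_sum[OF S _ that, of "vec (Suc k) (\<lambda>_. 1)"]
    by (simp add: W_def coeff_sum Nk1)
  have g: "gamma_vec k u $ m = u ^ e m" if "m \<le> k" for u m
    using that by (simp add: gamma_vec_def e_def)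
  have e0: "e 0 = 0" using k by (simp add: e_def)
  \<comment> \<open>The entry of \<open>gamma_vec\<close> at index 0 is 1, so the unknown factor at
    \<open>z\<close> is the value of \<open>W 0\<close>. The identity extends from the complement of
    \<open>Z\<close> to all \<open>z\<close>.\<close>
  have WG: "W m = W 0 * [:\<tau>, \<delta>:] ^ e m" if m: "m \<le> k" for m
  proof (rule poly_eqI_cofinite[OF Z])
    fix z assume "z \<notin> Z"
    then obtain c where c: "S *\<^sub>v nodal_vec k t s z = c \<cdot>\<^sub>v gamma_vec k (\<delta> * z + \<tau>)"
      using SN by blast
    have "poly (W i) z = c * (\<delta> * z + \<tau>) ^ e i" if "i \<le> k" for i
      unfolding Wz[OF that] c using g[OF that] that by (simp add: gamma_vec_def)
    from this[OF m] this[of 0] show "poly (W m) z = poly (W 0 * [:\<tau>, \<delta>:] ^ e m) z"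
      using e0 by (simp add: algebra_simps)
  qed
  \<comment> \<open>One point outside \<open>Z\<close>, where the factor is nonzero, shows that
    \<open>W 0\<close> is not the zero polynomial.\<close>
  have "infinite (UNIV - Z)" using Z infinite_UNIV_char_0 by (metis Diff_infinite_finite)
  then obtain z0 where z0: "z0 \<notin> Z" by (metis Diff_iff ex_in_conv finite.emptyI)
  then obtain c where c: "c \<noteq> 0" "S *\<^sub>v nodal_vec k t s z0 = c \<cdot>\<^sub>v gamma_vec k (\<delta> * z0 + \<tau>)"
    using SN by blast
  have "poly (W 0) z0 = c"
    unfolding Wz[OF le0] c(2) using g[of 0] e0 by (simp add: gamma_vec_def)
  then have W0: "W 0 \<noteq> 0" using c(1) by auto
  have "degree (W 0) + Suc k = degree (W k)"
    using \<delta> W0 unfolding WG[OF order_refl]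
    by (simp add: degree_mult_eq degree_power_eq e_def del: power_Suc)
  then have "degree (W 0) = 0" using degW[of k] by simp
  then obtain r where r: "W 0 = [:r:]" by (meson degree_eq_zeroE)
  show thesis
  proof (rule that[of r])
    show "r \<noteq> 0" using W0 r by auto
    show "S *\<^sub>v nodal_vec k t s z = r \<cdot>\<^sub>v gamma_vec k (\<delta> * z + \<tau>)" for z
    proof (rule eq_vecI)
      fix m assume "m < dim_vec (r \<cdot>\<^sub>v gamma_vec k (\<delta> * z + \<tau>))"
      then have m: "m \<le> k" by (simp add: gamma_vec_def)
      have "(S *\<^sub>v nodal_vec k t s z) $ m = r * (\<delta> * z + \<tau>) ^ e m"
        unfolding Wz[OF m, symmetric] WG[OF m] r by (simp add: algebra_simps)
      then show "(S *\<^sub>v nodal_vec k t s z) $ m = (r \<cdot>\<^sub>v gamma_vec k (\<delta> * z + \<tau>)) $ m"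
        using g[OF m] m by (simp add: gamma_vec_def)
    qed (use S in \<open>auto simp: gamma_vec_def\<close>)
    show "S *\<^sub>v vec (Suc k) (\<lambda>_. 1) = (r * \<delta> ^ Suc k) \<cdot>\<^sub>v unit_vec (Suc k) k"
    proof (rule eq_vecI)
      fix m assume "m < dim_vec ((r * \<delta> ^ Suc k) \<cdot>\<^sub>v unit_vec (Suc k) k)"
      then have m: "m \<le> k" by simp
      have "(S *\<^sub>v vec (Suc k) (\<lambda>_. 1)) $ m = r * coeff ([:\<tau>, \<delta>:] ^ e m) (Suc k)"
        unfolding Wk1[OF m, symmetric] WG[OF m] r by simp
      also have "coeff ([:\<tau>, \<delta>:] ^ e m) (Suc k) = (if m = k then \<delta> ^ Suc k else 0)"
      proof (cases "m = k")
        case True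
        then show ?thesis using coeff_linear_poly_power[of "Suc k" "Suc k" \<tau> \<delta>] by (simp add: e_def)
      next
        case False
        have "degree ([:\<tau>, \<delta>:] ^ e m) \<le> degree [:\<tau>, \<delta>:] * e m" by (rule degree_power_le)
        then have "degree ([:\<tau>, \<delta>:] ^ e m) < Suc k" using False m \<delta> by (simp add: e_def)
        then show ?thesis using False by (simp add: coeff_eq_0)
      qed
      finally show "(S *\<^sub>v vec (Suc k) (\<lambda>_. 1)) $ m = ((r * \<delta> ^ Suc k) \<cdot>\<^sub>v unit_vec (Suc k) k) $ m"
        using m by simp
    qed (use S in auto)
  qed
qed

section \<open>The conjugacy and the entries of \<open>L\<close>\<close>

text \<open>Raising both indices by one multiplies a difference \<open>t i - t j\<close> by
  \<open>\<delta>\<close>. Hence the two products match, up to a power of \<open>\<delta>\<close>,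
  except for the boundary factors \<open>t (Suc i) - t 0\<close> and \<open>t i - t k\<close>, whose
  ratio is cross-multiplied to avoid division.\<close>

lemma prod_diff_geometric_shift:
  fixes \<delta> a c :: "'a :: comm_ring_1"
  assumes "i < k" and t: "\<And>j. t j = \<delta> ^ j * a + c"
  shows "(\<Prod>j\<in>{..k} - {Suc i}. t (Suc i) - t j) * (\<delta> ^ i - \<delta> ^ k)
    = (\<Prod>j\<in>{..k} - {i}. t i - t j) * ((\<delta> ^ Suc i - 1) * \<delta> ^ (k - 1))"
proof -
  let ?A = "{..<k} - {i}"
  have A: "{..k} - {i} = insert k ?A" using assms(1) by auto
  have "{..k} = insert 0 (Suc ` {..<k})"
    by (auto simp: lessThan_Suc_atMost[symmetric] lessThan_Suc_eq_insert_0)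
  then have B: "{..k} - {Suc i} = insert 0 (Suc ` ?A)" by auto
  have "(\<Prod>j\<in>{..k} - {Suc i}. t (Suc i) - t j) = (t (Suc i) - t 0) * (\<Prod>j\<in>?A. t (Suc i) - t (Suc j))"
    unfolding B by (subst prod.insert) (auto simp: prod.reindex)
  also have "(\<Prod>j\<in>?A. t (Suc i) - t (Suc j)) = (\<Prod>j\<in>?A. \<delta> * (t i - t j))"
    by (intro prod.cong refl) (simp add: t algebra_simps)
  also have "\<dots> = \<delta> ^ (k - 1) * (\<Prod>j\<in>?A. t i - t j)"
    using assms(1) by (simp add: prod.distrib)
  finally have 1: "(\<Prod>j\<in>{..k} - {Suc i}. t (Suc i) - t j)
    = (t (Suc i) - t 0) * (\<delta> ^ (k - 1) * (\<Prod>j\<in>?A. t i - t j))" .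
  have 2: "(\<Prod>j\<in>{..k} - {i}. t i - t j) = (t i - t k) * (\<Prod>j\<in>?A. t i - t j)"
    unfolding A by (subst prod.insert) auto
  have "(t (Suc i) - t 0) * (\<delta> ^ i - \<delta> ^ k) = (t i - t k) * (\<delta> ^ Suc i - 1)"
    by (simp add: t algebra_simps)
  then have "(t (Suc i) - t 0) * (\<delta> ^ i - \<delta> ^ k) * (\<delta> ^ (k - 1) * (\<Prod>j\<in>?A. t i - t j))
    = (t i - t k) * (\<delta> ^ Suc i - 1) * (\<delta> ^ (k - 1) * (\<Prod>j\<in>?A. t i - t j))"
    by (rule arg_cong)
  then show ?thesis unfolding 1 2 by (simp only: mult_ac)
qed

lemma basic_cremona_conjugate:
  assumes S: "S \<in> carrier_mat (Suc k) (Suc k)" and T: "aut_mat k T"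
  shows "conjugate_via k T (basic_cremona k S T) (rat_map k (\<lambda>x. (inv_mat T * S) *\<^sub>v J_lift k x))"
proof (rule conjugate_viaI)
  let ?T' = "inv_mat T"
  show Tc: "T \<in> carrier_mat (Suc k) (Suc k)" using T by (simp add: aut_mat_def)
  note T' = aut_mat_inv[OF T]
  show "?T' \<in> carrier_mat (Suc k) (Suc k)" "T * ?T' = 1\<^sub>m (Suc k)" "?T' * T = 1\<^sub>m (Suc k)"
    using T' by auto
  have SJ: "S *\<^sub>v J_lift k x \<in> carrier_vec (Suc k)" for x
    using S by (rule mult_mat_vec_carrier) simp
  have LJ: "(?T' * S) *\<^sub>v J_lift k x = ?T' *\<^sub>v (S *\<^sub>v J_lift k x)" for x
    using T'(1) S by (rule assoc_mult_mat_vec) simp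
  show "H x \<in> carrier_vec (Suc k)" if "H \<in> basic_cremona k S T" "x \<in> carrier_vec (Suc k)" for H x
    using that unfolding basic_cremona_def rat_map_def is_lift_def by blast
  show "H x \<in> carrier_vec (Suc k)"
    if "H \<in> rat_map k (\<lambda>x. (?T' * S) *\<^sub>v J_lift k x)" "x \<in> carrier_vec (Suc k)" for H x
    using that unfolding rat_map_def is_lift_def by blast
  show "(\<lambda>x. ?T' *\<^sub>v H (T *\<^sub>v x)) \<in> rat_map k (\<lambda>x. (?T' * S) *\<^sub>v J_lift k x)"
    if "H \<in> basic_cremona k S T" for H
  proof (rule rat_map_conj[OF that[unfolded basic_cremona_def] _ T'(1) Tc T'(3,2)])
    show "(?T' * S) *\<^sub>v J_lift k x = ?T' *\<^sub>v (S *\<^sub>v J_lift k (?T' *\<^sub>v (T *\<^sub>v x)))"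
      if "x \<in> carrier_vec (Suc k)" for x
      using LJ mult_mat_vec_inverse[OF T'(1) Tc T'(3) that] by simp
  qed (rule SJ)
  show "(\<lambda>x. T *\<^sub>v H (?T' *\<^sub>v x)) \<in> basic_cremona k S T"
    if "H \<in> rat_map k (\<lambda>x. (?T' * S) *\<^sub>v J_lift k x)" for H
    unfolding basic_cremona_def
  proof (rule rat_map_conj[OF that _ Tc T'(1,2,3)])
    show "(?T' * S) *\<^sub>v J_lift k x \<in> carrier_vec (Suc k)" for x
      unfolding LJ using T'(1) SJ by (rule mult_mat_vec_carrier)
    show "S *\<^sub>v J_lift k (?T' *\<^sub>v x) = T *\<^sub>v ((?T' * S) *\<^sub>v J_lift k (?T' *\<^sub>v x))" for x
      unfolding LJ using mult_mat_vec_inverse[OF Tc T'(1,2) SJ] by simp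
  qed
qed

lemma basic_cremona_lift:
  assumes S: "aut_mat k S" and T: "aut_mat k T"
  shows "(\<lambda>x. S *\<^sub>v J_lift k (inv_mat T *\<^sub>v x)) \<in> basic_cremona k S T"
  unfolding basic_cremona_def rat_map_def
  using S T aut_mat_inv[OF S] aut_mat_inv[OF T] is_lift_J_lift
  by (auto intro!: is_lift_conj[of k _ S "inv_mat T" "inv_mat S" T] simp: aut_mat_def)

text \<open>A single lift that is nonzero at the point already places it outside the indeterminacy
  set, and its value there represents the image.\<close>

lemma rat_app_gamma_vec:
  assumes H: "H \<in> F" "H (gamma_vec k z) \<noteq> 0\<^sub>v (Suc k)"
    and mult: "gamma k z \<notin> indet k F \<Longrightarrow> rat_app k F (gamma k z) = gamma k u"
  shows "\<exists>c. c \<noteq> 0 \<and> H (gamma_vec k z) = c \<cdot>\<^sub>v gamma_vec k u"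
proof -
  have z: "gamma_vec k z \<in> gamma k z"
    unfolding gamma_eq_pt pt_def by (auto intro!: exI[of _ 1])
  then have "gamma k z \<notin> indet k F"
    using H unfolding indet_def by auto
  moreover have "H (gamma_vec k z) \<in> rat_app k F (gamma k z)"
    using H z unfolding rat_app_def by auto
  ultimately show ?thesis
    using mult unfolding gamma_eq_pt pt_def by auto
qed

text \<open>Each row of \<open>L_mat\<close> sums to 1, so the first \<open>k\<close> columns
  together with the eigenvector of ones determine the last column.\<close>

lemma same_aut_L_mat:
  assumes L: "L \<in> carrier_mat (Suc k) (Suc k)" and k: "k \<ge> 1" and C: "C \<noteq> 0"
    and L1: "L *\<^sub>v vec (Suc k) (\<lambda>_. 1) = C \<cdot>\<^sub>v vec (Suc k) (\<lambda>_. 1)"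
    and Le: "\<And>j. j < k \<Longrightarrow>
      L *\<^sub>v unit_vec (Suc k) j = (C * beta k \<delta> (Suc j)) \<cdot>\<^sub>v unit_vec (Suc k) (Suc j)"
  shows "same_aut L (L_mat k \<delta>)"
  unfolding same_aut_def
proof (intro exI conjI eq_matI)
  have col: "L $$ (i, j) = (if i = Suc j then C * beta k \<delta> i else 0)" if "i \<le> k" "j < k" for i j
  proof -
    have "L $$ (i, j) = (L *\<^sub>v unit_vec (Suc k) j) $ i" using L that by simp
    then show ?thesis unfolding Le[OF that(2)] using that by simp
  qed
  fix i j assume "i < dim_row (C \<cdot>\<^sub>m L_mat k \<delta>)" "j < dim_col (C \<cdot>\<^sub>m L_mat k \<delta>)"
  then have ij: "i \<le> k" "j \<le> k" by (auto simp: L_mat_def)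
  show "L $$ (i, j) = (C \<cdot>\<^sub>m L_mat k \<delta>) $$ (i, j)"
  proof (cases "j = k")
    case False
    then show ?thesis using ij col by (simp add: L_mat_def)
  next
    case True
    have "C = (L *\<^sub>v vec (Suc k) (\<lambda>_. 1)) $ i" unfolding L1 using ij by simp
    also have "\<dots> = (\<Sum>l\<le>k. L $$ (i, l))"
      using index_mult_mat_vec_sum[OF L, of "vec (Suc k) (\<lambda>_. 1)"] ij by simp
    also have "\<dots> = (\<Sum>l<k. L $$ (i, l)) + L $$ (i, k)"
      by (simp add: lessThan_Suc_atMost[symmetric])
    also have "(\<Sum>l<k. L $$ (i, l)) = (\<Sum>l<k. if i = Suc l then C * beta k \<delta> i else 0)"
      using ij by (intro sum.cong) (auto simp: col)
    also have "\<dots> = (if i = 0 then 0 else C * beta k \<delta> i)"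
      using ij by (cases i) auto
    finally show ?thesis using True ij by (auto simp: L_mat_def algebra_simps split: if_splits)
  qed
qed (use C L in \<open>auto simp: L_mat_def\<close>)

theorem theorem4p7:
  fixes k n :: nat and \<delta> :: complex and S T :: "complex mat" and F :: rational_map
  assumes "k \<ge> 2" and "n \<ge> 1"
    and "(\<delta> ^ (n + k) - 1) * (\<delta> ^ 2 - 1) - \<delta> * (\<delta> ^ (k + 1) - 1) * (\<delta> ^ (n - 1) - 1) = 0"
    and "\<forall>m\<ge>1. \<delta> ^ m \<noteq> 1"
    and "aut_mat k S" and "aut_mat k T"
    and "F = basic_cremona k S T"
    and "properly_fixes_C k S T"
    and "has_multiplier k F \<delta>"
    and a: "\<forall>j<k. aut_app S (coord_pt k j) = aut_app T (coord_pt k (j + 1))"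
    and b: "(rat_app k F ^^ (n - 1)) (aut_app S (coord_pt k k)) = aut_app T (coord_pt k 0)"
    and c: "\<forall>j<n - 1. (rat_app k F ^^ j) (aut_app S (coord_pt k k)) \<notin> indet k F"
    and d: "\<forall>j\<le>k. aut_app T (coord_pt k j) =
      gamma k (\<delta> ^ j * (of_nat (k + 1) / of_nat (k - 1)) *
                 ((\<delta> ^ 2 - 1) / (\<delta> * (\<delta> ^ (k + 1) - 1))) - 2 / of_nat (k - 1))"
    and "aut_app T (ones_pt k) = cusp k" and "aut_app S (ones_pt k) = cusp k"
  shows "same_aut (inv_mat T * S) (L_mat k \<delta>) \<and>
    conjugate_via k T F (rat_map k (\<lambda>x. (inv_mat T * S) *\<^sub>v J_lift k x))"
proof -
  \<comment> \<open>At zero the polynomial in the hypothesis takes the value 1.\<close>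
  have \<delta>0: "\<delta> \<noteq> 0"
    using assms(1,3) by (auto simp: power_0_left)
  have \<delta>1: "\<delta> \<noteq> 1" "\<delta> ^ 2 \<noteq> 1" "\<delta> ^ (k + 1) \<noteq> 1"
    using assms(4)[rule_format, of 1] assms(4)[rule_format, of 2] assms(4)[rule_format, of "k + 1"]
    by auto
  have \<delta>inj: "\<delta> ^ i \<noteq> \<delta> ^ j" if "i < j" for i j
  proof
    assume eq: "\<delta> ^ i = \<delta> ^ j"
    have "\<delta> ^ j = \<delta> ^ i * \<delta> ^ (j - i)"
      using that by (simp add: power_add[symmetric])
    then have "\<delta> ^ (j - i) = 1" using eq \<delta>0 by simp
    then show False using assms(4) that by simp
  qed
  define \<alpha> where "\<alpha> = of_nat (k + 1) / of_nat (k - 1) * ((\<delta> ^ 2 - 1) / (\<delta> * (\<delta> ^ (k + 1) - 1)))"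
  define t where "t j = \<delta> ^ j * \<alpha> + - 2 / of_nat (k - 1)" for j
  have kc: "of_nat (k - 1) \<noteq> (0 :: complex)" "of_nat (k + 1) \<noteq> (0 :: complex)"
    using assms(1) by (auto simp del: of_nat_add of_nat_Suc)
  have \<alpha>0: "\<alpha> \<noteq> 0"
    using \<delta>0 \<delta>1 kc by (simp add: \<alpha>_def)
  have t_inj: "t i \<noteq> t j" if "i \<noteq> j" for i j
    using \<delta>inj[of i j] \<delta>inj[of j i] that \<alpha>0 by (auto simp: t_def neq_iff)
  define s where "s i = - (\<Sum>j\<in>{..k} - {i}. t j)" for i
  define \<Sigma> where "\<Sigma> = (\<Sum>j\<le>k. t j)"
  have s_eq: "s i = t i - \<Sigma>" if "i \<le> k" for i
    using that sum.remove[of "{..k}" i t] by (simp add: s_def \<Sigma>_def)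
  \<comment> \<open>The closed form serves to show \<open>\<Sigma> \<noteq> 0\<close>: then
    \<open>s i\<close> differs from \<open>t i\<close>, and the nodal vectors do not vanish at their
    nodes.\<close>
  have "\<Sigma> = (\<Sum>j\<le>k. \<delta> ^ j) * \<alpha> - of_nat (k + 1) * 2 / of_nat (k - 1)"
    by (simp add: \<Sigma>_def t_def sum.distrib sum_distrib_right sum_subtractf)
  also have "(\<Sum>j\<le>k. \<delta> ^ j) = (\<delta> ^ (k + 1) - 1) / (\<delta> - 1)"
    using \<delta>1(1) geometric_sum[of \<delta> "Suc k"] by (simp add: lessThan_Suc_atMost)
  also have "\<dots> * \<alpha> = of_nat (k + 1) / of_nat (k - 1) * ((\<delta> + 1) / \<delta>)"
  proof -
    have "\<delta> ^ 2 - 1 = (\<delta> - 1) * (\<delta> + 1)" by (simp add: power2_eq_square algebra_simps)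
    then show ?thesis using \<delta>1(1,3) by (simp add: \<alpha>_def)
  qed
  also have "of_nat (k + 1) / of_nat (k - 1) * ((\<delta> + 1) / \<delta>) - of_nat (k + 1) * 2 / of_nat (k - 1)
      = of_nat (k + 1) / of_nat (k - 1) * ((1 - \<delta>) / \<delta>)"
  proof -
    have "p / q * ((\<delta> + 1) / \<delta>) - p * 2 / q = p / q * ((1 - \<delta>) / \<delta>)" if "q \<noteq> 0" for p q :: complex
      using \<delta>0 that by (simp add: field_simps)
    then show ?thesis using kc(1) by blast
  qed
  finally have "\<Sigma> = of_nat (k + 1) / of_nat (k - 1) * ((1 - \<delta>) / \<delta>)" .
  then have \<Sigma>0: "\<Sigma> \<noteq> 0" using \<delta>0 \<delta>1 kc by simp

  let ?T' = "inv_mat T" and ?one = "vec (Suc k) (\<lambda>_. 1) :: complex vec"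
  have Sc: "S \<in> carrier_mat (Suc k) (Suc k)" and Tc: "T \<in> carrier_mat (Suc k) (Suc k)"
    using assms(5,6) by (auto simp: aut_mat_def)
  note S' = aut_mat_inv[OF assms(5)]
  note T' = aut_mat_inv[OF assms(6)]
  have Te_pt: "aut_app T (coord_pt k j) = pt (gamma_vec k (t j))" if "j \<le> k" for j
    using d that by (simp add: gamma_eq_pt t_def \<alpha>_def mult.assoc)
  have Te: "\<exists>c. c \<noteq> 0 \<and> T *\<^sub>v unit_vec (Suc k) j = c \<cdot>\<^sub>v gamma_vec k (t j)" if "j \<le> k" for j
    using Te_pt[OF that] aut_app_pt[OF Tc, of "unit_vec (Suc k) j"] unfolding coord_pt_def
    by (auto elim: pt_eqD)
  obtain \<mu> where \<mu>: "\<mu> \<noteq> 0" "T *\<^sub>v ?one = \<mu> \<cdot>\<^sub>v unit_vec (Suc k) k"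
    using assms(14) aut_app_pt[OF Tc, of ?one] unfolding ones_pt_def cusp_def coord_pt_def
    by (auto elim: pt_eqD)
  have Tg: "?T' *\<^sub>v gamma_vec k z = (1 / \<mu>) \<cdot>\<^sub>v nodal_vec k s t z" for z
    using inverse_gamma_vec[OF Tc T'(1,3) Te _ \<mu>(2,1)] t_inj
    unfolding s_def by (auto simp: inj_on_def)

  obtain \<tau> where \<tau>: "\<And>z. gamma k z \<notin> indet k F \<Longrightarrow> rat_app k F (gamma k z) = gamma k (\<delta> * z + \<tau>)"
    using assms(9) unfolding has_multiplier_def by auto
  \<comment> \<open>Avoiding the \<open>t j\<close> keeps the scalar \<open>q\<close> produced by
    \<open>J\<close> nonzero; avoiding the \<open>s j\<close> as well keeps the nodal vector
    nonzero, so the invertible \<open>S\<close> does not kill it.\<close>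
  have Snodal: "\<exists>c. c \<noteq> 0 \<and> S *\<^sub>v nodal_vec k t s z = c \<cdot>\<^sub>v gamma_vec k (\<delta> * z + \<tau>)"
    if z: "z \<notin> t ` {..k} \<union> s ` {..k}" for z
  proof -
    define q where "q = (1 / \<mu>) ^ k * (\<Prod>j\<le>k. z - t j) ^ (k - 1)"
    have q0: "q \<noteq> 0" using z \<mu>(1) by (auto simp: q_def)
    have "J_lift k (?T' *\<^sub>v gamma_vec k z) = q \<cdot>\<^sub>v nodal_vec k t s z"
      using z assms(1) by (simp add: Tg J_lift_smult J_lift_nodal_vec smult_smult_assoc q_def)
    then have G: "S *\<^sub>v J_lift k (?T' *\<^sub>v gamma_vec k z) = q \<cdot>\<^sub>v (S *\<^sub>v nodal_vec k t s z)"
      using mult_mat_vec[OF Sc nodal_vec_carrier] by simp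
    have nz: "nodal_vec k t s z $ 0 \<noteq> 0" using z by (auto simp: nodal_vec_def)
    have "q \<cdot>\<^sub>v (S *\<^sub>v nodal_vec k t s z) \<noteq> 0\<^sub>v (Suc k)"
    proof
      assume "q \<cdot>\<^sub>v (S *\<^sub>v nodal_vec k t s z) = 0\<^sub>v (Suc k)"
      then have "S *\<^sub>v (q \<cdot>\<^sub>v nodal_vec k t s z) = 0\<^sub>v (Suc k)"
        using mult_mat_vec[OF Sc nodal_vec_carrier] by simp
      then have "q \<cdot>\<^sub>v nodal_vec k t s z = inv_mat S *\<^sub>v 0\<^sub>v (Suc k)"
        using mult_mat_vec_inverse[OF S'(1) Sc S'(3), of "q \<cdot>\<^sub>v nodal_vec k t s z"] by simp
      also have "\<dots> = 0\<^sub>v (Suc k)" using S'(1) by (auto intro!: eq_vecI)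
      finally have "(q \<cdot>\<^sub>v nodal_vec k t s z) $ 0 = 0" by simp
      then show False using q0 nz by (simp add: nodal_vec_def)
    qed
    then obtain c where c: "c \<noteq> 0"
      "S *\<^sub>v J_lift k (?T' *\<^sub>v gamma_vec k z) = c \<cdot>\<^sub>v gamma_vec k (\<delta> * z + \<tau>)"
      using rat_app_gamma_vec[OF basic_cremona_lift[OF assms(5,6)], folded assms(7), OF _ \<tau>, of z] G
      by auto
    have "S *\<^sub>v nodal_vec k t s z = (1 / q) \<cdot>\<^sub>v (q \<cdot>\<^sub>v (S *\<^sub>v nodal_vec k t s z))"
      using q0 by (simp add: smult_smult_assoc)
    also have "\<dots> = (c / q) \<cdot>\<^sub>v gamma_vec k (\<delta> * z + \<tau>)"
      unfolding G[symmetric] c(2) by (simp add: smult_smult_assoc)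
    finally show ?thesis using c(1) q0 by (intro exI[of _ "c / q"]) auto
  qed
  have k1: "k \<ge> 1" and fin: "finite (t ` {..k} \<union> s ` {..k})" using assms(1) by auto
  obtain r where r: "r \<noteq> 0" "\<And>z. S *\<^sub>v nodal_vec k t s z = r \<cdot>\<^sub>v gamma_vec k (\<delta> * z + \<tau>)"
    "S *\<^sub>v ?one = (r * \<delta> ^ Suc k) \<cdot>\<^sub>v unit_vec (Suc k) k"
    by (rule nodal_vec_image_gamma[OF Sc k1 \<delta>0 fin Snodal], assumption) (rule that)

  \<comment> \<open>The \<open>s i\<close> are the \<open>t i\<close> translated by a constant, so
    both families have the same differences and share the scale \<open>D\<close>.\<close>
  define D where "D i = (\<Prod>j\<in>{..k} - {i}. t i - t j)" for i
  have D0: "D i \<noteq> 0" for i using t_inj by (auto simp: D_def)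
  have node_s: "nodal_vec k t s (s i) = (- \<Sigma> * D i) \<cdot>\<^sub>v unit_vec (Suc k) i" if "i \<le> k" for i
  proof -
    have "(\<Prod>j\<in>{..k} - {i}. s i - s j) = D i"
      unfolding D_def using that by (intro prod.cong refl) (auto simp: s_eq)
    then show ?thesis using nodal_vec_at_node[OF that, of t s] s_eq[OF that] by simp
  qed
  have node_t: "nodal_vec k s t (t i) = (\<Sigma> * D i) \<cdot>\<^sub>v unit_vec (Suc k) i" if "i \<le> k" for i
    using nodal_vec_at_node[OF that, of s t] s_eq[OF that] by (simp add: D_def)
  have shift: "\<delta> * s i + \<tau> = t (Suc i)" if "i < k" for i
  proof -
    have "pt (S *\<^sub>v unit_vec (Suc k) i) = pt (gamma_vec k (t (Suc i)))"
      using a Te_pt[of "Suc i"] that aut_app_pt[OF Sc, of "unit_vec (Suc k) i"]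
      by (simp add: coord_pt_def)
    then obtain c where c: "S *\<^sub>v unit_vec (Suc k) i = c \<cdot>\<^sub>v gamma_vec k (t (Suc i))"
      by (rule pt_eqD)
    have "r \<cdot>\<^sub>v gamma_vec k (\<delta> * s i + \<tau>) = (- \<Sigma> * D i) \<cdot>\<^sub>v (S *\<^sub>v unit_vec (Suc k) i)"
      unfolding r(2)[symmetric] using node_s[of i] that mult_mat_vec[OF Sc] by simp
    then have eq: "r \<cdot>\<^sub>v gamma_vec k (\<delta> * s i + \<tau>) = (- \<Sigma> * D i * c) \<cdot>\<^sub>v gamma_vec k (t (Suc i))"
      unfolding c by (simp add: smult_smult_assoc)
    \<comment> \<open>Entry 0 of \<open>gamma_vec\<close> is 1 and fixes the scalar; entry 1 is the
      parameter itself because \<open>k \<ge> 2\<close>.\<close>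
    from arg_cong[OF eq, of "\<lambda>v. v $ 0"] have "r = - \<Sigma> * D i * c"
      using assms(1) by (simp add: gamma_vec_def)
    moreover from arg_cong[OF eq, of "\<lambda>v. v $ 1"]
    have "r * (\<delta> * s i + \<tau>) = - \<Sigma> * D i * c * t (Suc i)"
      using assms(1) by (simp add: gamma_vec_def)
    ultimately show ?thesis using r(1) by simp
  qed
  \<comment> \<open>The sign comes from \<open>\<delta> ^ (k + 1) - \<delta> ^ Suc i\<close>, which
    is minus \<open>\<delta>\<close> times the factor \<open>\<delta> ^ i - \<delta> ^ k\<close> of
    the shift formula.\<close>
  have D_ratio: "D (Suc i) = - D i * (\<delta> ^ Suc k * beta k \<delta> (Suc i))" if "i < k" for i
  proof -
    have nz: "\<delta> ^ i - \<delta> ^ k \<noteq> 0" using \<delta>inj that by auto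
    have "\<delta> ^ Suc k * beta k \<delta> (Suc i) * (\<delta> ^ i - \<delta> ^ k) = - ((\<delta> ^ Suc i - 1) * \<delta> ^ (k - 1))"
    proof -
      have "\<delta> ^ (k + 1) - \<delta> ^ Suc i = - (\<delta> * (\<delta> ^ i - \<delta> ^ k))" by (simp add: algebra_simps)
      then have "beta k \<delta> (Suc i) = (\<delta> ^ Suc i - 1) / (\<delta> * - (\<delta> * (\<delta> ^ i - \<delta> ^ k)))"
        unfolding beta_def by simp
      moreover have "\<delta> ^ Suc k = \<delta> ^ (k - 1) * (\<delta> * \<delta>)"
        using assms(1) by (simp add: power_eq_if)
      moreover have "w * (\<delta> * \<delta>) * (y / (\<delta> * - (\<delta> * x))) * x = - (y * w)"
        if "x \<noteq> 0" for w x y :: complex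
        using that \<delta>0 by (simp add: field_simps)
      ultimately show ?thesis using nz by metis
    qed
    moreover have "D (Suc i) * (\<delta> ^ i - \<delta> ^ k) = D i * ((\<delta> ^ Suc i - 1) * \<delta> ^ (k - 1))"
      unfolding D_def using that t_def by (rule prod_diff_geometric_shift)
    ultimately have "D (Suc i) * (\<delta> ^ i - \<delta> ^ k)
        = - D i * (\<delta> ^ Suc k * beta k \<delta> (Suc i)) * (\<delta> ^ i - \<delta> ^ k)"
      by (metis mult.assoc mult_minus_left mult_minus_right minus_minus)
    then show ?thesis unfolding mult_right_cancel[OF nz] .
  qed

  let ?L = "?T' * S"
  \<comment> \<open>The eigenvalue of \<open>?L\<close> on the vector of ones: \<open>S\<close> and
    \<open>T\<close> send that vector to \<open>r * \<delta> ^ Suc k\<close> and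
    \<open>\<mu>\<close> times the cusp vector.\<close>
  define C where "C = r * \<delta> ^ Suc k / \<mu>"
  have Lv: "?L *\<^sub>v x = ?T' *\<^sub>v (S *\<^sub>v x)" if "x \<in> carrier_vec (Suc k)" for x
    using T'(1) Sc that by (rule assoc_mult_mat_vec)
  have L1: "?L *\<^sub>v ?one = C \<cdot>\<^sub>v ?one"
  proof -
    have "unit_vec (Suc k) k = (1 / \<mu>) \<cdot>\<^sub>v (T *\<^sub>v ?one)"
      unfolding \<mu>(2) using \<mu>(1) by (simp add: smult_smult_assoc)
    then have "S *\<^sub>v ?one = T *\<^sub>v (C \<cdot>\<^sub>v ?one)"
      using r(3) mult_mat_vec[OF Tc, of ?one] by (simp add: smult_smult_assoc C_def)
    then show ?thesis
      using Lv[of ?one] mult_mat_vec_inverse[OF T'(1) Tc T'(3), of "C \<cdot>\<^sub>v ?one"] by simp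
  qed
  \<comment> \<open>Follow the nodal vector at \<open>s j\<close>: \<open>S\<close> maps it to
    \<open>r\<close> times the curve vector at \<open>t (Suc j)\<close>, which \<open>?T'\<close>
    maps to a multiple of the next unit vector. The scalars compare through \<open>D (Suc j)\<close>
    and \<open>D j\<close>.\<close>
  have Le: "?L *\<^sub>v unit_vec (Suc k) j = (C * beta k \<delta> (Suc j)) \<cdot>\<^sub>v unit_vec (Suc k) (Suc j)"
    if j: "j < k" for j
  proof -
    have SD: "- \<Sigma> * D j \<noteq> 0" using \<Sigma>0 D0 by simp
    have "(- \<Sigma> * D j) \<cdot>\<^sub>v (?L *\<^sub>v unit_vec (Suc k) j) = ?L *\<^sub>v nodal_vec k t s (s j)"
      using node_s[of j] j mult_mat_vec[of ?L "Suc k" "Suc k"] T'(1) Sc by simp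
    also have "\<dots> = ?T' *\<^sub>v (r \<cdot>\<^sub>v gamma_vec k (t (Suc j)))"
      by (simp add: Lv r(2) shift[OF j])
    also have "\<dots> = (r * (1 / \<mu>) * (\<Sigma> * D (Suc j))) \<cdot>\<^sub>v unit_vec (Suc k) (Suc j)"
      using mult_mat_vec[OF T'(1) gamma_vec_carrier] node_t[of "Suc j"] j
      by (simp add: Tg smult_smult_assoc mult.assoc)
    also have "r * (1 / \<mu>) * (\<Sigma> * D (Suc j)) = (- \<Sigma> * D j) * (C * beta k \<delta> (Suc j))"
      unfolding D_ratio[OF j] C_def by simp
    finally have "(1 / (- \<Sigma> * D j)) \<cdot>\<^sub>v ((- \<Sigma> * D j) \<cdot>\<^sub>v (?L *\<^sub>v unit_vec (Suc k) j)) =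
      (1 / (- \<Sigma> * D j)) \<cdot>\<^sub>v ((- \<Sigma> * D j * (C * beta k \<delta> (Suc j))) \<cdot>\<^sub>v unit_vec (Suc k) (Suc j))"
      by simp
    then show ?thesis using SD unfolding smult_smult_assoc by simp
  qed
  have "same_aut ?L (L_mat k \<delta>)"
  proof (rule same_aut_L_mat[OF _ _ _ L1 Le])
    show "?L \<in> carrier_mat (Suc k) (Suc k)" using T'(1) Sc by simp
    show "k \<ge> 1" using assms(1) by simp
    show "C \<noteq> 0" using r(1) \<delta>0 \<mu>(1) by (simp add: C_def)
  qed
  then show ?thesis
    using basic_cremona_conjugate[OF Sc assms(6)] assms(7) by simp
qed

end
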